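(* Let $f\in L^1(\mathbb{T}^\omega)$ and let $a>\|f\|_1$. Then there exist a closed set $F_a\subset\mathbb{T}^\omega$ and an open set $\Omega_a=\mathbb{T}^\omega\setminus F_a$ such that: (i) $|f(x)|\le a$ for almost all $x\in F_a$; (ii) $\Omega_a$ is the union of an at most countable (possibly finite or empty) family $\{I_j\}$ of pairwise disjoint intervals belonging to $\mathcal{R}_0$ such that, for every $j$, $$a\le \frac{1}{m(I_j)}\int_{I_j}|f(x)|\,dx\le 2a;$$ (iii) $m(\Omega_a)\le \dfrac{\|f\|_1}{a}$.
   Context: $\mathbb{T}=\mathbb{R}/\mathbb{Z}$ is identified with $[0,1)$. $\mathbb{T}^\omega$ is the compact abelian group given by the product of countably infinitely many copies of $\mathbb{T}$, with the product topology and coordinatewise addition mod 1. $m$ (or $dx$) is its Haar measure normalized by $m(\mathbb{T}^\omega)=1$, i.e. the product of the Lebesgue measures; $L^1(\mathbb{T}^\omega)$ and $\|\cdot\|_1$ are with respect to $m$. For $n\in\mathbb{N}=\{1,2,\dots\}$ write $\mathbb{T}^\omega=\mathbb{T}^n\times\mathbb{T}^{n,\omega}$, where $\mathbb{T}^{n,\omega}$ is the copy of the infinite torus with coordinates $x_{n+1},x_{n+2},\dots$, and let $\bar 0^{(n}$ denote the zero element of $\mathbb{T}^{n,\omega}$. For $k\in\mathbb{N}$ let $R_k=\{0,\frac1k,\dots,\frac{k-1}k\}\subset\mathbb{T}$. Define finite subgroups $H_m$ and open sets $V_m$ of $\mathbb{T}^\omega$, $m\in\mathbb{N}$, by $H_1=R_2\times\{\bar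 0^{(1}\}$, $V_1=(0,\frac12)\times\mathbb{T}^{1,\omega}$ and, for $n\ge1$ and $1\le j\le 2n+1$, $H_{n^2+j}=\widetilde H_{n^2+j}\times\{\bar0^{(n+1}\}$ and $V_{n^2+j}=\widetilde V_{n^2+j}\times\mathbb{T}^{n+1,\omega}$, where: - if $1\le j\le n$: $\widetilde H_{n^2+j}=(R_{2^n})^n\times R_{2^j}$ and $\widetilde V_{n^2+j}=(0,\frac1{2^n})^n\times(0,\frac1{2^j})$; - if $n+1\le j\le 2n+1$: $\widetilde H_{n^2+j}=(R_{2^{n+1}})^{j-n}\times(R_{2^n})^{2n+1-j}$ and $\widetilde V_{n^2+j}=(0,\frac1{2^{n+1}})^{j-n}\times(0,\frac1{2^n})^{2n+1-j}$. The family of dyadic intervals is $\mathcal{R}_0=\{t+V_m\colon m\in\mathbb{N},\ t\in H_m\}$. *)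

theory Defs
  imports
    "HOL-Probability.Probability"
    "HOL-Library.Function_Algebras"
    "HOL-Library.Discrete_Functions"
begin

section \<open>The circle group\<close>

quotient_type circle = real / "\<lambda>x y :: real. x - y \<in> \<int>"
proof (rule equivpI)
  show "reflp (\<lambda>x y :: real. x - y \<in> \<int>)"
    by (simp add: reflp_def)
  show "symp (\<lambda>x y :: real. x - y \<in> \<int>)"
    by (rule sympI) (metis Ints_minus minus_diff_eq)
  show "transp (\<lambda>x y :: real. x - y \<in> \<int>)"
  proof (rule transpI)
    fix x y z :: real
    assume "x - y \<in> \<int>" "y - z \<in> \<int>"
    then have "(x - y) + (y - z) \<in> \<int>" by (rule Ints_add)
    then show "x - z \<in> \<int>" by simp
  qed
qed

lift_definition circle_of :: "real \<Rightarrow> circle" is "\<lambda>x. x" .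

instantiation circle :: ab_group_add
begin

lift_definition zero_circle :: circle is "0 :: real" .

lift_definition plus_circle :: "circle \<Rightarrow> circle \<Rightarrow> circle" is "(+) :: real \<Rightarrow> real \<Rightarrow> real"
proof -
  fix a b c d :: real
  assume "a - b \<in> \<int>" "c - d \<in> \<int>"
  then have "(a - b) + (c - d) \<in> \<int>" by (rule Ints_add)
  then show "(a + c) - (b + d) \<in> \<int>" by (simp add: algebra_simps)
qed

lift_definition uminus_circle :: "circle \<Rightarrow> circle" is "uminus :: real \<Rightarrow> real"
proof -
  fix a b :: real
  assume "a - b \<in> \<int>"
  then have "- (a - b) \<in> \<int>" by (rule Ints_minus)
  then show "- a - (- b) \<in> \<int>" by simp
qed

lift_definition minus_circle :: "circle \<Rightarrow> circle \<Rightarrow> circle" is "(-) :: real \<Rightarrow> real \<Rightarrow> real"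
proof -
  fix a b c d :: real
  assume "a - b \<in> \<int>" "c - d \<in> \<int>"
  then have "(a - b) - (c - d) \<in> \<int>" by (rule Ints_diff)
  then show "(a - c) - (b - d) \<in> \<int>" by (simp add: algebra_simps)
qed

instance
  by standard (transfer; simp)+

end

instantiation circle :: topological_space
begin

text \<open>The quotient topology.\<close>

definition open_circle :: "circle set \<Rightarrow> bool" where
  "open_circle U \<longleftrightarrow> open (circle_of -` U)"

instance
  by standard (auto simp: open_circle_def vimage_Union)

end

text \<open>Every class has exactly one representative in \<open>[0, 1)\<close>; the measure below is Lebesgue
  measure carried over by this identification.\<close>

lemma bij_betw_circle_of: "bij_betw circle_of {0..<1} UNIV"
proof (rule bij_betwI')
  fix x y :: real
  assume "x \<in> {0..<1}" "y \<in> {0..<1}"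
  then have "\<bar>x - y\<bar> < 1" by auto
  then have "x - y \<in> \<int> \<longleftrightarrow> x = y"
    using Ints_nonzero_abs_less1[of "x - y"] by auto
  then show "(circle_of x = circle_of y) = (x = y)"
    by (simp add: circle_of.abs_eq circle.abs_eq_iff)
next
  fix c :: circle
  obtain r where r: "c = circle_of r"
    using circle.abs_induct[of "\<lambda>c. \<exists>r. c = circle_of r" c]
    unfolding circle_of.abs_eq by blast
  have "r - frac r \<in> \<int>" by (simp add: frac_def)
  then have "c = circle_of (frac r)"
    unfolding r by (simp add: circle_of.abs_eq circle.abs_eq_iff)
  then show "\<exists>x\<in>{0..<1}. c = circle_of x"
    using frac_ge_0[of r] frac_lt_1[of r] by auto
qed simp

lemma continuous_on_circle_of: "continuous_on UNIV circle_of"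
  by (simp add: continuous_on_open_vimage open_circle_def)

lemma measurable_circle_of [measurable]: "circle_of \<in> borel_measurable borel"
  by (rule borel_measurable_continuous_onI[OF continuous_on_circle_of])

definition circle_measure :: "circle measure" where
  "circle_measure = distr (restrict_space lborel {0..<1}) borel circle_of"


section \<open>The infinite torus\<close>

text \<open>Coordinates are numbered from \<open>0\<close>: \<open>x i\<close> is the coordinate usually written \<open>x\<^sub>i\<^sub>+\<^sub>1\<close>.
  Topology and group structure are those of the library's instances for function types, that is,
  the product topology and pointwise addition.\<close>

type_synonym inf_torus = "nat \<Rightarrow> circle"

definition haar :: "inf_torus measure" where
  "haar = PiM UNIV (\<lambda>_. circle_measure)"

lemma prob_space_circle_measure: "prob_space circle_measure"
proof -
  have "prob_space (restrict_space lborel {0..<1::real})"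
    by (rule prob_spaceI) (simp add: space_restrict_space emeasure_restrict_space)
  then show ?thesis
    unfolding circle_measure_def
    by (rule prob_space.prob_space_distr) (simp add: measurable_restrict_space1)
qed

lemma prob_space_haar: "prob_space haar"
  unfolding haar_def by (intro prob_space_PiM prob_space_circle_measure)


section \<open>Dyadic intervals\<close>

definition circle_R :: "nat \<Rightarrow> circle set" where
  "circle_R k = {circle_of (real i / real k) | i. i < k}"

definition circle_I :: "nat \<Rightarrow> circle set" where
  "circle_I k = circle_of ` {0<..<1 / real k}"

definition block_H :: "nat \<Rightarrow> nat \<Rightarrow> inf_torus set" where
  "block_H n j =
     (if j \<le> n
      then {x. (\<forall>i<n. x i \<in> circle_R (2 ^ n)) \<and> x n \<in> circle_R (2 ^ j) \<and> (\<forall>i>n. x i = 0)}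
      else {x. (\<forall>i<j - n. x i \<in> circle_R (2 ^ (n + 1))) \<and>
               (\<forall>i\<in>{j - n..n}. x i \<in> circle_R (2 ^ n)) \<and> (\<forall>i>n. x i = 0)})"

definition block_V :: "nat \<Rightarrow> nat \<Rightarrow> inf_torus set" where
  "block_V n j =
     (if j \<le> n
      then {x. (\<forall>i<n. x i \<in> circle_I (2 ^ n)) \<and> x n \<in> circle_I (2 ^ j)}
      else {x. (\<forall>i<j - n. x i \<in> circle_I (2 ^ (n + 1))) \<and>
               (\<forall>i\<in>{j - n..n}. x i \<in> circle_I (2 ^ n))})"

text \<open>Each \<open>m \<ge> 2\<close> is \<open>n\<^sup>2 + j\<close> for unique \<open>n \<ge> 1\<close> and \<open>1 \<le> j \<le> 2n + 1\<close>, namely with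
  \<open>n = \<lfloor>sqrt (m - 1)\<rfloor>\<close>. The value at \<open>m = 0\<close> is irrelevant.\<close>

definition dyadic_H :: "nat \<Rightarrow> inf_torus set" where
  "dyadic_H m =
     (if m = 1 then {x. x 0 \<in> circle_R 2 \<and> (\<forall>i>0. x i = 0)}
      else let n = floor_sqrt (m - 1) in block_H n (m - n\<^sup>2))"

definition dyadic_V :: "nat \<Rightarrow> inf_torus set" where
  "dyadic_V m =
     (if m = 1 then {x. x 0 \<in> circle_I 2}
      else let n = floor_sqrt (m - 1) in block_V n (m - n\<^sup>2))"

lemma floor_sqrt_block:
  assumes "1 \<le> j" "j \<le> 2 * n + 1"
  shows "floor_sqrt (n\<^sup>2 + j - 1) = n"
  using assms by (intro floor_sqrt_unique) (auto simp: power2_eq_square)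

lemma dyadic_H_block:
  assumes "1 \<le> n" "1 \<le> j" "j \<le> 2 * n + 1"
  shows "dyadic_H (n\<^sup>2 + j) = block_H n j"
proof -
  have "0 < n\<^sup>2" using assms by simp
  then have "n\<^sup>2 + j \<noteq> 1" using assms(2) by linarith
  then show ?thesis using floor_sqrt_block[OF assms(2,3)] by (simp add: dyadic_H_def)
qed

lemma dyadic_V_block:
  assumes "1 \<le> n" "1 \<le> j" "j \<le> 2 * n + 1"
  shows "dyadic_V (n\<^sup>2 + j) = block_V n j"
proof -
  have "0 < n\<^sup>2" using assms by simp
  then have "n\<^sup>2 + j \<noteq> 1" using assms(2) by linarith
  then show ?thesis using floor_sqrt_block[OF assms(2,3)] by (simp add: dyadic_V_def)
qed

definition dyadic_intervals :: "inf_torus set set" where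
  "dyadic_intervals = {(+) t ` dyadic_V m | m t. 1 \<le> m \<and> t \<in> dyadic_H m}"

end

theory Submission
  imports Defs
begin

text \<open>
  Passing from \<open>m\<close> to \<open>m + 1\<close> halves exactly one side of the intervals of generation \<open>m\<close>, so up to
  null sets the generations form refining partitions into sets of measure \<open>2\<^sup>-\<^sup>m\<close>, where generation
  \<open>0\<close> is the whole torus. Stop at the first generation at which the average of \<open>|f|\<close> reaches \<open>a\<close>:
  as \<open>a > \<parallel>f\<parallel>\<^sub>1\<close> this is never generation \<open>0\<close>, and the parent has average below \<open>a\<close>, so the
  stopped intervals have average between \<open>a\<close> and \<open>2a\<close>, and summing over them bounds the
  measure of their union. On the remaining set \<open>F\<close>, the integral of \<open>a - |f|\<close> over \<open>F \<inter> B\<close> is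
  nonnegative for every finite union \<open>B\<close> of intervals of one generation. These sets \<open>B\<close> generate
  the Borel sets, so \<open>|f| \<le> a\<close> almost everywhere on \<open>F\<close> by approximation in measure, without a
  differentiation or martingale convergence theorem.
\<close>

section \<open>Integrals over the sets of a generating algebra\<close>

lemma integrable_imp_set_integrable:
  fixes f :: "'a \<Rightarrow> 'b::{banach, second_countable_topology}"
  shows "integrable M f \<Longrightarrow> A \<in> sets M \<Longrightarrow> set_integrable M A f"
  unfolding set_integrable_def by (rule integrable_mult_indicator)

lemma set_integral_nonneg_mono:
  fixes g :: "'a \<Rightarrow> real"
  assumes "integrable M g" "\<And>x. 0 \<le> g x" "A \<in> sets M" "B \<in> sets M" "A \<subseteq> B"
  shows "(LINT x:A|M. g x) \<le> (LINT x:B|M. g x)"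
  unfolding set_lebesgue_integral_def
  using assms integrable_imp_set_integrable[OF assms(1)]
  by (intro integral_mono) (auto simp: set_integrable_def split: split_indicator)

text \<open>Induction over \<open>sigma_sets\<close>: complements leave symmetric differences
  unchanged, and a countable union is first cut off at a finite stage, after which finitely many
  approximants are joined inside the algebra.\<close>

lemma (in finite_measure) approximation_by_algebra:
  assumes "algebra (space M) G" and sets: "sets M = sigma_sets (space M) G"
    and "A \<in> sets M" and "0 < e"
  obtains B where "B \<in> G" "measure M (sym_diff A B) < e"
proof -
  interpret G: algebra "space M" G by fact
  have G_sets [measurable]: "B \<in> sets M" if "B \<in> G" for B
    using that by (simp add: sets)
  have "A \<in> sigma_sets (space M) G"
    using assms by simp
  then have "\<forall>e>0. \<exists>B\<in>G. measure M (sym_diff A B) < e"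
  proof induction
    case (Basic A)
    then show ?case by (force intro: bexI[of _ A])
  next
    case Empty
    then show ?case by (force intro: bexI[of _ "{}"])
  next
    case (Compl A)
    have A: "A \<subseteq> space M"
      using Compl.hyps sets sets.sets_into_space by auto
    show ?case
    proof (intro allI impI)
      fix e :: real assume "0 < e"
      with Compl.IH obtain B where B: "B \<in> G" "measure M (sym_diff A B) < e" by blast
      then have "sym_diff (space M - A) (space M - B) = sym_diff A B"
        using A G.sets_into_space by blast
      with B show "\<exists>B\<in>G. measure M (sym_diff (space M - A) B) < e"
        by (intro bexI[of _ "space M - B"]) auto
    qed
  next
    case (Union A)
    have A [measurable]: "A i \<in> sets M" for i
      using Union.hyps sets by simp
    show ?case
    proof (intro allI impI)
      fix e :: real assume "0 < e"
      \<comment> \<open>Half of \<open>e\<close> is kept for the tail of the union. The other half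
        is spread geometrically over the sets, so that any finite number of these errors still adds
        up to at most \<open>e / 2\<close>.\<close>
      have "\<exists>B\<in>G. measure M (sym_diff (A i) B) < e / 2 * (1/2) ^ Suc i" for i
        using \<open>0 < e\<close> by (intro Union.IH[rule_format]) simp
      then obtain B where B: "\<And>i. B i \<in> G"
        "\<And>i. measure M (sym_diff (A i) (B i)) < e / 2 * (1/2) ^ Suc i"
        by metis
      have B_sets [measurable]: "B i \<in> sets M" for i
        using B by auto
      have "(\<lambda>n. measure M (\<Union>i\<le>n. A i)) \<longlonglongrightarrow> measure M (\<Union>n. \<Union>i\<le>n. A i)"
        by (rule finite_Lim_measure_incseq) (auto simp: incseq_def intro: order_trans)
      moreover have "(\<Union>n. \<Union>i\<le>n. A i) = (\<Union>i. A i)" by auto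
      ultimately have "(\<lambda>n. measure M (\<Union>i\<le>n. A i)) \<longlonglongrightarrow> measure M (\<Union>i. A i)" by simp
      then have "\<forall>\<^sub>F n in sequentially. measure M (\<Union>i. A i) - e / 2 < measure M (\<Union>i\<le>n. A i)"
        by (rule order_tendstoD) (use \<open>0 < e\<close> in simp)
      then obtain n where n: "measure M (\<Union>i. A i) - e / 2 < measure M (\<Union>i\<le>n. A i)"
        using eventually_happens by force
      have tail: "measure M ((\<Union>i. A i) - (\<Union>i\<le>n. A i)) < e / 2"
        using n by (subst finite_measure_Diff) auto
      have "measure M (\<Union>i\<le>n. sym_diff (A i) (B i)) \<le> (\<Sum>i\<le>n. measure M (sym_diff (A i) (B i)))"
        by (rule finite_measure_subadditive_finite) auto
      also have "\<dots> \<le> (\<Sum>i\<le>n. e / 2 * (1/2) ^ Suc i)"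
        using B(2) by (intro sum_mono) (simp add: less_imp_le)
      also have "\<dots> = e / 2 * (\<Sum>i\<le>n. (1/2) ^ Suc i)"
        by (simp add: sum_distrib_left)
      also have "(\<Sum>i\<le>n. (1/2) ^ Suc i :: real) = 1 - (1/2) ^ Suc n"
        by (induction n) (auto simp: field_simps)
      also have "e / 2 * (1 - (1/2) ^ Suc n) \<le> e / 2"
        using \<open>0 < e\<close> by (simp add: field_simps)
      finally have head: "measure M (\<Union>i\<le>n. sym_diff (A i) (B i)) \<le> e / 2" .
      have "measure M (sym_diff (\<Union>i. A i) (\<Union>i\<le>n. B i)) \<le>
          measure M (((\<Union>i. A i) - (\<Union>i\<le>n. A i)) \<union> (\<Union>i\<le>n. sym_diff (A i) (B i)))"
        by (rule finite_measure_mono) auto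
      also have "\<dots> \<le> measure M ((\<Union>i. A i) - (\<Union>i\<le>n. A i)) +
          measure M (\<Union>i\<le>n. sym_diff (A i) (B i))"
        by (rule measure_Un_le) auto
      also have "\<dots> < e"
        using head tail by simp
      finally have "measure M (sym_diff (\<Union>i. A i) (\<Union>i\<le>n. B i)) < e" .
      moreover have "(\<Union>i\<le>n. B i) \<in> G"
        using B(1) by (intro G.finite_UN) auto
      ultimately show "\<exists>B\<in>G. measure M (sym_diff (\<Union>i. A i) B) < e" by blast
    qed
  qed
  with \<open>0 < e\<close> that show ?thesis by blast
qed

text \<open>It suffices that every measurable \<open>A\<close> has a nonnegative integral.
  Approximating \<open>A\<close> by a member \<open>B\<close> of the algebra changes the integral of
  \<open>h\<close> by an arbitrarily small amount.\<close>

lemma (in finite_measure) AE_nonneg_if_integral_nonneg_on_algebra: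
  fixes h :: "'a \<Rightarrow> real"
  assumes h: "integrable M h" and G: "algebra (space M) G" "sets M = sigma_sets (space M) G"
    and nonneg: "\<And>B. B \<in> G \<Longrightarrow> 0 \<le> (LINT x:B|M. h x)"
  shows "AE x in M. 0 \<le> h x"
proof (rule density_nonneg[OF h])
  fix A assume A [measurable]: "A \<in> sets M"
  have [measurable]: "h \<in> borel_measurable M" using h by auto
  \<comment> \<open>Approximation takes place in the finite measure with density
    \<open>\<bar>h\<bar>\<close>. The measure of a symmetric difference is then itself the bound for
    the change of the integral.\<close>
  let ?D = "density M (\<lambda>x. ennreal \<bar>h x\<bar>)"
  have D: "emeasure ?D S = ennreal (LINT x:S|M. \<bar>h x\<bar>)" if [measurable]: "S \<in> sets M" for S
  proof -
    have int: "integrable M (\<lambda>x. indicator S x * \<bar>h x\<bar>)"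
      using integrable_mult_indicator[OF that integrable_abs[OF h]] by simp
    have "emeasure ?D S = (\<integral>\<^sup>+x. ennreal (indicator S x * \<bar>h x\<bar>) \<partial>M)"
      by (subst emeasure_density) (auto intro!: nn_integral_cong split: split_indicator)
    also have "\<dots> = ennreal (LINT x:S|M. \<bar>h x\<bar>)"
      unfolding set_lebesgue_integral_def real_scaleR_def
      by (rule nn_integral_eq_integral[OF int]) auto
    finally show ?thesis .
  qed
  interpret D: finite_measure ?D
    by (rule finite_measureI) (simp add: D)
  have int: "integrable M (\<lambda>x. indicator S x * h x)" "integrable M (\<lambda>x. indicator S x * \<bar>h x\<bar>)"
    if "S \<in> sets M" for S
    using integrable_mult_indicator[OF that h] integrable_mult_indicator[OF that integrable_abs[OF h]]
    by simp_all
  have "- (LINT x:A|M. h x) \<le> e" if "0 < e" for e :: real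
  proof -
    obtain B where B: "B \<in> G" and e: "measure ?D (sym_diff A B) < e"
      by (rule D.approximation_by_algebra[of G A e]) (use G A \<open>0 < e\<close> in auto)
    have [measurable]: "B \<in> sets M" using B G by auto
    have "(LINT x:B|M. h x) - (LINT x:A|M. h x) =
        (LINT x|M. indicator B x * h x - indicator A x * h x)"
      unfolding set_lebesgue_integral_def real_scaleR_def
      by (rule Bochner_Integration.integral_diff[symmetric])
        (simp_all add: int)
    \<comment> \<open>The two indicators differ only on the symmetric difference, and there by
      one.\<close>
    also have "\<dots> \<le> (LINT x:sym_diff A B|M. \<bar>h x\<bar>)"
      unfolding set_lebesgue_integral_def real_scaleR_def
      by (rule integral_mono)
        (auto intro!: int Bochner_Integration.integrable_diff split: split_indicator)
    also have "\<dots> = measure ?D (sym_diff A B)"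
    proof -
      have "0 \<le> (LINT x:sym_diff A B|M. \<bar>h x\<bar>)"
        unfolding set_lebesgue_integral_def by (rule integral_nonneg_AE) auto
      then show ?thesis
        by (simp add: measure_def D)
    qed
    finally show ?thesis
      using e nonneg[OF B] by linarith
  qed
  then have "- (LINT x:A|M. h x) \<le> 0"
    by (rule dense_ge)
  then show "0 \<le> (LINT x:A|M. h x)" by simp
qed

section \<open>Stopping times for halving filtrations\<close>

text \<open>The label \<open>code m x\<close> names the piece of generation \<open>m\<close>
  containing \<open>x\<close>. Labels turn refinement into an implication between equalities, and
  the prescribed measures force every piece to split into exactly two pieces of the next
  generation.\<close>

locale halving_filtration = prob_space M
  for M :: "'a measure" +
  fixes code :: "nat \<Rightarrow> 'a \<Rightarrow> 'b"
  assumes finite_code: "finite (code m ` space M)"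
    and code_sets: "{y \<in> space M. code m y = s} \<in> sets M"
    and code_Suc: "\<lbrakk>x \<in> space M; y \<in> space M; code (Suc m) x = code (Suc m) y\<rbrakk>
      \<Longrightarrow> code m x = code m y"
    and measure_code: "x \<in> space M \<Longrightarrow> measure M {y \<in> space M. code m y = code m x} = 1 / 2 ^ m"
    and generated: "sets M = sigma_sets (space M) {{x \<in> space M. code m x \<in> S} | m S. True}"
begin

definition atom :: "nat \<Rightarrow> 'a \<Rightarrow> 'a set" where
  "atom m x = {y \<in> space M. code m y = code m x}"

text \<open>The factor \<open>2 ^ m\<close> is the reciprocal of the measure of the atom.\<close>

definition avg :: "('a \<Rightarrow> real) \<Rightarrow> nat \<Rightarrow> 'a \<Rightarrow> real" where
  "avg g m x = 2 ^ m * (LINT y:atom m x|M. g y)"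

definition stops :: "('a \<Rightarrow> real) \<Rightarrow> real \<Rightarrow> nat \<Rightarrow> 'a \<Rightarrow> bool" where
  "stops g a m x \<longleftrightarrow> a \<le> avg g m x \<and> (\<forall>k<m. avg g k x < a)"

lemma atom_sets [measurable]: "atom m x \<in> sets M"
  unfolding atom_def by (rule code_sets)

lemma measure_atom: "x \<in> space M \<Longrightarrow> measure M (atom m x) = 1 / 2 ^ m"
  unfolding atom_def by (rule measure_code)

lemma code_mono:
  assumes "x \<in> space M" "y \<in> space M" "code n x = code n y" "m \<le> n"
  shows "code m x = code m y"
  using assms(4,3) by (induction rule: dec_induct) (auto dest: code_Suc[OF assms(1,2)])

lemma atom_mono: "x \<in> space M \<Longrightarrow> m \<le> n \<Longrightarrow> atom n x \<subseteq> atom m x"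
  unfolding atom_def by (auto intro: code_mono)

lemma avg_cong: "code m x = code m y \<Longrightarrow> avg g m x = avg g m y"
  unfolding avg_def atom_def by simp

text \<open>Finer labels determine coarser ones, so \<open>code m\<close> fixes all averages up to
  generation \<open>m\<close>: stopping is decided without looking ahead.\<close>

lemma stops_cong:
  assumes "x \<in> space M" "y \<in> space M" "code m x = code m y"
  shows "stops g a m x \<longleftrightarrow> stops g a m y"
proof -
  have "avg g k x = avg g k y" if "k \<le> m" for k
    using code_mono[OF assms that] by (rule avg_cong)
  then show ?thesis unfolding stops_def by auto
qed

lemma stops_unique: "stops g a m x \<Longrightarrow> stops g a n x \<Longrightarrow> m = n"
  unfolding stops_def by (metis linorder_neqE_nat not_le)

lemma ex_stops: "a \<le> avg g m x \<Longrightarrow> \<exists>n. stops g a n x"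
  using exists_least_iff[of "\<lambda>n. a \<le> avg g n x"] unfolding stops_def not_le by blast

text \<open>These are the events of the sigma-algebra generated by \<open>code m\<close>, that is,
  unions of atoms of one generation.\<close>

definition saturated :: "nat \<Rightarrow> 'a set \<Rightarrow> bool" where
  "saturated m B \<longleftrightarrow> B \<subseteq> space M \<and> (\<forall>x\<in>B. atom m x \<subseteq> B)"

lemma saturated_eq_UN:
  assumes "saturated m B"
  shows "B = (\<Union>s\<in>code m ` B. {y \<in> space M. code m y = s})"
  using assms unfolding saturated_def atom_def by auto

lemma finite_code_image: "saturated m B \<Longrightarrow> finite (code m ` B)"
  unfolding saturated_def by (meson finite_code finite_subset image_mono)

lemma saturated_sets:
  assumes "saturated m B" shows "B \<in> sets M"
  by (subst saturated_eq_UN[OF assms])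
    (intro sets.finite_UN finite_code_image[OF assms] code_sets)

lemma saturated_mono: "saturated m B \<Longrightarrow> m \<le> n \<Longrightarrow> saturated n B"
  unfolding saturated_def using atom_mono by blast

lemma integral_saturated:
  fixes h :: "'a \<Rightarrow> real"
  assumes h: "integrable M h" and B: "saturated m B"
  shows "(LINT x:B|M. h x) = (\<Sum>s\<in>code m ` B. LINT x:{y \<in> space M. code m y = s}|M. h x)"
proof -
  have "(LINT x:B|M. h x) = (LINT x:(\<Union>s\<in>code m ` B. {y \<in> space M. code m y = s})|M. h x)"
    using saturated_eq_UN[OF B] by simp
  also have "\<dots> = (\<Sum>s\<in>code m ` B. LINT x:{y \<in> space M. code m y = s}|M. h x)"
    by (rule set_integral_finite_Union)
      (use h in \<open>auto simp: disjoint_family_on_def finite_code_image[OF B] code_sets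
        intro!: integrable_imp_set_integrable\<close>)
  finally show ?thesis .
qed

lemma integral_nonneg_saturated:
  fixes h :: "'a \<Rightarrow> real"
  assumes h: "integrable M h" and B: "saturated m B"
    and nonneg: "\<And>x. x \<in> B \<Longrightarrow> 0 \<le> avg h m x"
  shows "0 \<le> (LINT x:B|M. h x)"
  unfolding integral_saturated[OF h B]
proof (rule sum_nonneg)
  fix s assume "s \<in> code m ` B"
  then obtain x where "x \<in> B" "s = code m x" by blast
  with nonneg[of x] show "0 \<le> (LINT x:{y \<in> space M. code m y = s}|M. h x)"
    by (simp add: avg_def atom_def zero_le_mult_iff del: power_le_zero_eq)
      (metis not_le zero_less_numeral zero_less_power)
qed

lemma avg_diff_const:
  assumes g: "integrable M g" and "x \<in> space M"
  shows "avg (\<lambda>y. g y - a) m x = avg g m x - a"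
proof -
  have "set_integrable M (atom m x) g" "set_integrable M (atom m x) (\<lambda>_. a)"
    using g by (auto intro!: integrable_imp_set_integrable)
  then have "(LINT y:atom m x|M. g y - a) = (LINT y:atom m x|M. g y) - a / 2 ^ m"
    using measure_atom[OF assms(2)] by (simp add: set_integral_const emeasure_eq_measure)
  then show ?thesis by (simp add: avg_def right_diff_distrib)
qed

lemma avg_uminus: "avg (\<lambda>y. - g y) m x = - avg g m x"
  by (simp add: avg_def set_lebesgue_integral_def)

text \<open>Passing from a child to its parent cannot decrease the integral of a nonnegative
  function; the factor 2 is the ratio of the two measures.\<close>

lemma avg_Suc_le:
  assumes g: "integrable M g" "\<And>x. 0 \<le> g x" and x: "x \<in> space M"
  shows "avg g (Suc m) x \<le> 2 * avg g m x"
proof -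
  have "(LINT y:atom (Suc m) x|M. g y) \<le> (LINT y:atom m x|M. g y)"
    using g atom_mono[OF x, of m "Suc m"] by (intro set_integral_nonneg_mono) auto
  then show ?thesis by (simp add: avg_def)
qed

lemma avg_0:
  fixes g :: "'a \<Rightarrow> real"
  assumes x: "x \<in> space M" and [measurable]: "g \<in> borel_measurable M"
  shows "avg g 0 x = (LINT y|M. g y)"
proof -
  \<comment> \<open>The atom of generation 0 has full measure, so restricting the integral to it
    changes nothing.\<close>
  have "AE y in M. y \<in> atom 0 x"
    using measure_atom[OF x, of 0] by (subst AE_in_set_eq_1) auto
  then have "(LINT y:atom 0 x|M. g y) = (LINT y|M. g y)"
    unfolding set_lebesgue_integral_def by (intro integral_cong_AE) auto
  then show ?thesis by (simp add: avg_def)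
qed

lemma stops_bounds:
  assumes g: "integrable M g" "\<And>x. 0 \<le> g x" and a: "(LINT x|M. g x) < a"
    and x: "x \<in> space M" and stops: "stops g a m x"
  shows "0 < m" "a \<le> avg g m x" "avg g m x \<le> 2 * a"
proof -
  show "a \<le> avg g m x" using stops by (simp add: stops_def)
  show "0 < m"
    using a stops avg_0[OF x, of g] g(1) by (cases m) (auto simp: stops_def)
  then obtain n where m: "m = Suc n" using gr0_implies_Suc by blast
  then have "avg g n x < a" using stops by (simp add: stops_def)
  then show "avg g m x \<le> 2 * a" using avg_Suc_le[OF g x, of n] m by simp
qed

text \<open>Cut off to the set where all averages stay below \<open>a\<close>, the function
  \<open>a - g\<close> has a nonnegative integral over every union of atoms of one generation, by a
  limit over finite stages. The criterion for generating algebras finishes the argument.\<close>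

lemma AE_le_if_avg_less:
  assumes g: "integrable M g"
  shows "AE x in M. (\<forall>m. avg g m x < a) \<longrightarrow> g x \<le> a"
proof -
  \<comment> \<open>Testing only generations up to \<open>n\<close> keeps \<open>F n\<close> a union
    of atoms of generation \<open>n\<close>; the condition on all generations is the decreasing
    limit.\<close>
  define F where "F n = {x \<in> space M. \<forall>k\<le>n. avg g k x < a}" for n
  have F: "saturated n (F n)" for n
    unfolding saturated_def
  proof (intro conjI ballI subsetI)
    fix x y assume x: "x \<in> F n" and "y \<in> atom n x"
    then have y: "y \<in> space M" "x \<in> space M" "code n y = code n x"
      by (auto simp: atom_def F_def)
    have "avg g k y < a" if "k \<le> n" for k
      using avg_cong[OF code_mono[OF y that], of g] x that by (simp add: F_def)
    then show "y \<in> F n" using y by (simp add: F_def)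
  qed (auto simp: F_def)
  have F_antimono: "F n \<subseteq> F k" if "k \<le> n" for k n
    using that by (auto simp: F_def)
  have F_sets [measurable]: "F n \<in> sets M" for n
    using F by (rule saturated_sets)
  let ?G = "{{x \<in> space M. code m x \<in> S} | m S. True}"
  have saturated_code: "saturated m {x \<in> space M. code m x \<in> S}" for m S
    by (auto simp: saturated_def atom_def)
  define h where "h x = indicator (\<Inter>n. F n) x * (a - g x)" for x
  have ag: "integrable M (\<lambda>x. a - g x)" using g by simp
  have h: "integrable M h"
    using integrable_mult_indicator[OF _ ag, of "\<Inter>n. F n"] by (simp add: h_def[abs_def])
  have alg: "algebra (space M) ?G"
    unfolding algebra_iff_Un
  proof (intro conjI ballI)
    show "{} \<in> ?G" by (rule CollectI, rule exI, rule exI[of _ "{}"]) simp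
  next
    fix A assume "A \<in> ?G"
    then obtain m S where "A = {x \<in> space M. code m x \<in> S}" by blast
    then have "space M - A = {x \<in> space M. code m x \<in> - S}" by auto
    then show "space M - A \<in> ?G" by blast
  next
    fix A B assume "A \<in> ?G" "B \<in> ?G"
    then obtain m n S T where A: "A = {x \<in> space M. code m x \<in> S}"
      and B: "B = {x \<in> space M. code n x \<in> T}" by blast
    \<comment> \<open>Two events of different generations are compared in the later one, where their
      union is again determined by the label.\<close>
    have "saturated (max m n) A" "saturated (max m n) B"
      unfolding A B by (auto intro: saturated_mono[OF saturated_code])
    then have "saturated (max m n) (A \<union> B)" by (auto simp: saturated_def)
    then have "A \<union> B = {x \<in> space M. code (max m n) x \<in> code (max m n) ` (A \<union> B)}"
      using saturated_eq_UN[of "max m n" "A \<union> B"] by (auto simp: A B)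
    then show "A \<union> B \<in> ?G" by blast
  qed auto
  have "AE x in M. 0 \<le> h x"
  proof (rule AE_nonneg_if_integral_nonneg_on_algebra[OF h alg generated])
    fix B assume "B \<in> ?G"
    then obtain m S where B: "B = {x \<in> space M. code m x \<in> S}" by blast
    have sB: "saturated m B" unfolding B by (rule saturated_code)
    then have [measurable]: "B \<in> sets M" by (rule saturated_sets)
    have int: "set_integrable M A (\<lambda>x. a - g x)" if "A \<in> sets M" for A
      using ag that by (rule integrable_imp_set_integrable)
    \<comment> \<open>The shift by \<open>m\<close> makes both \<open>B\<close> and
      \<open>F (m + n)\<close> unions of atoms of the same generation \<open>m + n\<close>, on each
      of which the average of \<open>a - g\<close> is positive.\<close>
    have "0 \<le> (LINT x:B \<inter> F (m + n)|M. a - g x)" for n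
    proof (rule integral_nonneg_saturated[OF ag, of "m + n"])
      show "saturated (m + n) (B \<inter> F (m + n))"
        using saturated_mono[OF sB, of "m + n"] F[of "m + n"] by (auto simp: saturated_def)
    next
      fix x assume "x \<in> B \<inter> F (m + n)"
      then have "x \<in> space M" "avg g (m + n) x < a" by (auto simp: F_def)
      then show "0 \<le> avg (\<lambda>x. a - g x) (m + n) x"
        using avg_diff_const[OF g, of x a] avg_uminus[of "\<lambda>y. g y - a" "m + n" x] by simp
    qed
    moreover have "(\<lambda>n. LINT x:B \<inter> F (m + n)|M. a - g x) \<longlonglongrightarrow>
        (LINT x:(\<Inter>n. B \<inter> F (m + n))|M. a - g x)"
      by (rule set_integral_cont_down) (use F_antimono[of "m + _" "m + _"] in \<open>auto intro!: int simp: decseq_def\<close>)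
    ultimately have "0 \<le> (LINT x:(\<Inter>n. B \<inter> F (m + n))|M. a - g x)"
      by (intro LIMSEQ_le_const) auto
    also have "(\<Inter>n. B \<inter> F (m + n)) = B \<inter> (\<Inter>n. F n)"
    proof -
      have "F (m + n) \<subseteq> F n" for n by (rule F_antimono) simp
      then show ?thesis by blast
    qed
    also have "(LINT x:B \<inter> (\<Inter>n. F n)|M. a - g x) = (LINT x:B|M. h x)"
      unfolding set_lebesgue_integral_def h_def
      by (intro Bochner_Integration.integral_cong) (auto split: split_indicator)
    finally show "0 \<le> (LINT x:B|M. h x)" .
  qed
  then show ?thesis
    using AE_space by eventually_elim (auto simp: h_def F_def split: split_indicator_asm)
qed

lemma saturated_stops: "saturated m {x \<in> space M. stops g a m x}"
  unfolding saturated_def atom_def using stops_cong by blast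

text \<open>Each set \<open>E m\<close> of points stopped at generation \<open>m\<close> carries a
  nonnegative integral of \<open>g - a\<close>. Adding over the disjoint sets up to \<open>n\<close>
  bounds \<open>a\<close> times their measure by the integral of \<open>g\<close>, and
  \<open>n\<close> then tends to infinity.\<close>

lemma measure_stops_le:
  assumes g: "integrable M g" "\<And>x. 0 \<le> g x" and a: "0 < a"
  shows "measure M {x \<in> space M. \<exists>m. stops g a m x} \<le> (LINT x|M. g x) / a"
proof -
  define E where "E m = {x \<in> space M. stops g a m x}" for m
  have E [measurable]: "E m \<in> sets M" for m
    unfolding E_def by (rule saturated_sets[OF saturated_stops])
  have ga: "integrable M (\<lambda>x. g x - a)" using g by simp
  have int: "set_integrable M A (\<lambda>x. g x - a)" if "A \<in> sets M" for A
    using ga that by (rule integrable_imp_set_integrable)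
  have E_nonneg: "0 \<le> (LINT x:E m|M. g x - a)" for m
    unfolding E_def
    by (rule integral_nonneg_saturated[OF ga saturated_stops])
      (auto simp: avg_diff_const[OF g(1)] stops_def)
  have E_disjoint: "E m \<inter> E n = {}" if "m \<noteq> n" for m n
    using that stops_unique unfolding E_def by blast
  have nonneg: "0 \<le> (LINT x:(\<Union>m\<le>n. E m)|M. g x - a)" for n
  proof -
    have "(LINT x:(\<Union>m\<le>n. E m)|M. g x - a) = (\<Sum>m\<le>n. LINT x:E m|M. g x - a)"
      by (rule set_integral_finite_Union)
        (use E_disjoint in \<open>auto simp: disjoint_family_on_def int\<close>)
    then show ?thesis using E_nonneg by (simp add: sum_nonneg)
  qed
  have bound: "measure M (\<Union>m\<le>n. E m) \<le> (LINT x|M. g x) / a" for n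
  proof -
    let ?U = "\<Union>m\<le>n. E m"
    have "set_integrable M ?U g" "set_integrable M ?U (\<lambda>_. a)"
      using g by (auto intro!: integrable_imp_set_integrable)
    then have "(LINT x:?U|M. g x - a) = (LINT x:?U|M. g x) - a * measure M ?U"
      by (simp add: set_integral_const emeasure_eq_measure)
    moreover have "(LINT x:?U|M. g x) \<le> (LINT x|M. g x)"
      using set_integral_nonneg_mono[of M g ?U "space M"] g sets.sets_into_space[of ?U M]
      by (simp add: set_integral_space)
    ultimately show ?thesis
      using nonneg[of n] a by (simp add: field_simps)
  qed
  have "(\<lambda>n. measure M (\<Union>m\<le>n. E m)) \<longlonglongrightarrow> measure M (\<Union>n. \<Union>m\<le>n. E m)"
    by (rule finite_Lim_measure_incseq) (auto simp: incseq_def intro: order_trans)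
  then have "measure M (\<Union>n. \<Union>m\<le>n. E m) \<le> (LINT x|M. g x) / a"
    by (rule LIMSEQ_le_const2) (use bound in auto)
  also have "(\<Union>n. \<Union>m\<le>n. E m) = {x \<in> space M. \<exists>m. stops g a m x}"
    by (auto simp: E_def)
  finally show ?thesis .
qed

end

section \<open>Representatives in the unit interval\<close>

definition circle_rep :: "circle \<Rightarrow> real" where
  "circle_rep = the_inv_into {0..<1} circle_of"

lemma circle_rep_bounds: "0 \<le> circle_rep z" "circle_rep z < 1"
  using bij_betwE[OF bij_betw_the_inv_into[OF bij_betw_circle_of]]
  by (auto simp: circle_rep_def)

lemma circle_of_rep [simp]: "circle_of (circle_rep z) = z"
  unfolding circle_rep_def by (rule f_the_inv_into_f_bij_betw[OF bij_betw_circle_of]) simp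

lemma circle_of_eq_iff: "circle_of x = circle_of y \<longleftrightarrow> x - y \<in> \<int>"
  by (simp add: circle_of.abs_eq circle.abs_eq_iff)

lemma circle_rep_of: "circle_rep (circle_of r) = frac r"
proof -
  have "circle_of r = circle_of (frac r)"
    by (simp add: circle_of_eq_iff frac_def)
  then show ?thesis
    using the_inv_into_f_f[OF bij_betw_imp_inj_on[OF bij_betw_circle_of], of "frac r"]
    by (simp add: circle_rep_def frac_ge_0 frac_lt_1)
qed

lemma circle_of_add: "circle_of x + circle_of y = circle_of (x + y)"
  by (simp add: circle_of.abs_eq plus_circle.abs_eq)

text \<open>The representative jumps only at the zero of the circle, which the strict inequality
  with \<open>0 \<le> \<alpha>\<close> excludes. Upstairs the set is a union of integer translates
  of one open interval.\<close>

lemma open_circle_rep_interval: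
  assumes "0 \<le> \<alpha>" "\<beta> \<le> 1"
  shows "open {z. \<alpha> < circle_rep z \<and> circle_rep z < \<beta>}"
proof -
  have "circle_of -` {z. \<alpha> < circle_rep z \<and> circle_rep z < \<beta>} =
      (\<Union>n::int. {of_int n + \<alpha><..<of_int n + \<beta>})"
  proof (intro set_eqI iffI)
    fix r assume "r \<in> circle_of -` {z. \<alpha> < circle_rep z \<and> circle_rep z < \<beta>}"
    then have "r \<in> {of_int \<lfloor>r\<rfloor> + \<alpha><..<of_int \<lfloor>r\<rfloor> + \<beta>}"
      by (simp add: circle_rep_of frac_def algebra_simps)
    then show "r \<in> (\<Union>n::int. {of_int n + \<alpha><..<of_int n + \<beta>})" by blast
  next
    fix r assume "r \<in> (\<Union>n::int. {of_int n + \<alpha><..<of_int n + \<beta>})"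
    then obtain n :: int where n: "of_int n + \<alpha> < r" "r < of_int n + \<beta>" by auto
    then have "\<lfloor>r\<rfloor> = n" using assms by (intro floor_unique) linarith+
    then show "r \<in> circle_of -` {z. \<alpha> < circle_rep z \<and> circle_rep z < \<beta>}"
      using n by (simp add: circle_rep_of frac_def algebra_simps)
  qed
  then show ?thesis by (simp add: open_circle_def open_UN)
qed

lemma measurable_circle_rep [measurable]: "circle_rep \<in> borel_measurable borel"
  unfolding borel_measurable_iff_greater
proof
  fix c :: real
  have "{z \<in> space borel. c < circle_rep z} =
      (if c < 0 then UNIV else {z. c < circle_rep z \<and> circle_rep z < 1})"
    using circle_rep_bounds by (auto intro: less_le_trans)
  then show "{z \<in> space borel. c < circle_rep z} \<in> sets borel"
    using open_circle_rep_interval[of c 1] by (simp add: borel_open)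
qed

lemma sets_circle_measure [measurable_cong, simp]: "sets circle_measure = sets borel"
  by (simp add: circle_measure_def)

lemma space_circle_measure [simp]: "space circle_measure = UNIV"
  by (simp add: circle_measure_def)

lemma measurable_circle_of_unit: "circle_of \<in> restrict_space lborel {0..<1} \<rightarrow>\<^sub>M borel"
  by (simp add: measurable_restrict_space1)

lemma dyadic_bounds:
  fixes j :: int
  assumes "0 \<le> j" "j < 2 ^ k"
  shows "0 \<le> of_int j / (2 ^ k :: real)" "(of_int j + 1) / 2 ^ k \<le> (1 :: real)"
proof -
  have "real_of_int (j + 1) \<le> real_of_int (2 ^ k)"
    using assms(2) by (simp only: of_int_le_iff)
  then show "(of_int j + 1) / 2 ^ k \<le> (1 :: real)" by simp
qed (use assms in simp)

lemma emeasure_circle_floor: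
  assumes "0 \<le> j" "j < 2 ^ k"
  shows "emeasure circle_measure {z. \<lfloor>2 ^ k * circle_rep z\<rfloor> = j} = ennreal (1 / 2 ^ k)"
proof -
  have "{z. \<lfloor>2 ^ k * circle_rep z\<rfloor> = j} \<in> sets borel"
    by measurable
  then have "emeasure circle_measure {z. \<lfloor>2 ^ k * circle_rep z\<rfloor> = j} =
      emeasure (restrict_space lborel {0..<1})
        (circle_of -` {z. \<lfloor>2 ^ k * circle_rep z\<rfloor> = j} \<inter> {0..<1})"
    unfolding circle_measure_def
    by (subst emeasure_distr[OF measurable_circle_of_unit]) (auto simp: space_restrict_space)
  also have "circle_of -` {z. \<lfloor>2 ^ k * circle_rep z\<rfloor> = j} \<inter> {0..<1} =
      {of_int j / 2 ^ k..<(of_int j + 1) / 2 ^ k}"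
  proof -
    have *: "\<lfloor>2 ^ k * frac r\<rfloor> = j \<and> 0 \<le> r \<and> r < 1 \<longleftrightarrow>
        of_int j / 2 ^ k \<le> r \<and> r < (of_int j + 1) / 2 ^ k" for r :: real
    proof -
      have "\<lfloor>2 ^ k * r\<rfloor> = j \<longleftrightarrow> of_int j / 2 ^ k \<le> r \<and> r < (of_int j + 1) / 2 ^ k"
        unfolding floor_eq_iff by (simp add: field_simps)
      moreover have "0 \<le> r \<and> r < 1" if "of_int j / 2 ^ k \<le> r" "r < (of_int j + 1) / 2 ^ k"
        using that(1) less_le_trans[OF that(2) dyadic_bounds(2)[OF assms]] dyadic_bounds(1)[OF assms]
        by simp
      ultimately show ?thesis
        using frac_eq[of r] by metis
    qed
    show ?thesis
      by (simp only: set_eq_iff vimage_eq Int_iff mem_Collect_eq circle_rep_of atLeastLessThan_iff *) simp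
  qed
  also have "emeasure (restrict_space lborel {0..<1}) \<dots> = emeasure lborel \<dots>"
  proof (rule emeasure_restrict_space)
    show "{of_int j / 2 ^ k..<(of_int j + 1) / 2 ^ k} \<subseteq> {0..<1 :: real}"
    proof
      fix r :: real assume r: "r \<in> {of_int j / 2 ^ k..<(of_int j + 1) / 2 ^ k}"
      have "0 \<le> r" by (rule order_trans[OF dyadic_bounds(1)[OF assms]]) (use r in simp)
      moreover have "r < 1" by (rule less_le_trans[OF _ dyadic_bounds(2)[OF assms]]) (use r in simp)
      ultimately show "r \<in> {0..<1}" by simp
    qed
  qed simp
  also have "\<dots> = ennreal (1 / 2 ^ k)"
    by (subst emeasure_lborel_Ico) (auto simp: field_simps)
  finally show ?thesis .
qed

text \<open>The exceptional points are countable. This is what identifies open arcs with half-open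
  ones up to null sets.\<close>

lemma AE_circle_not_dyadic: "AE z in circle_measure. 2 ^ k * circle_rep z \<notin> \<int>"
proof -
  have "countable ((\<lambda>j. j / 2 ^ k) ` (\<int> :: real set))"
    by (auto simp: Ints_def)
  then have "AE r in lborel. (r::real) \<notin> (\<lambda>j. j / 2 ^ k) ` \<int>"
    by (intro AE_not_in countable_imp_null_set_lborel)
  then have "AE r in lborel. r \<in> {0..<1} \<longrightarrow> 2 ^ k * circle_rep (circle_of r) \<notin> \<int>"
  proof eventually_elim
    fix r :: real assume r: "r \<notin> (\<lambda>j. j / 2 ^ k) ` \<int>"
    show "r \<in> {0..<1} \<longrightarrow> 2 ^ k * circle_rep (circle_of r) \<notin> \<int>"
    proof (intro impI notI)
      assume "r \<in> {0..<1}" "2 ^ k * circle_rep (circle_of r) \<in> \<int>"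
      then have "2 ^ k * r \<in> \<int>" using frac_eq[of r] by (simp add: circle_rep_of)
      then have "r \<in> (\<lambda>j. j / 2 ^ k) ` \<int>" by (intro image_eqI[of _ _ "2 ^ k * r"]) auto
      with r show False by simp
    qed
  qed
  then have "AE r in restrict_space lborel {0..<1}. 2 ^ k * circle_rep (circle_of r) \<notin> \<int>"
    by (subst AE_restrict_space_iff) auto
  moreover have "{z. 2 ^ k * circle_rep z \<notin> \<int>} \<in> sets borel"
  proof -
    have "(\<lambda>z. 2 ^ k * circle_rep z) -` (- \<int>) \<inter> space borel \<in> sets borel"
      by (rule measurable_sets[of _ _ borel]) (auto simp: borel_closed)
    then show ?thesis by (simp add: vimage_def)
  qed
  ultimately show ?thesis
    unfolding circle_measure_def
    by (subst AE_distr_iff[OF measurable_circle_of_unit]) auto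
qed

text \<open>For \<open>j\<close> in this range the translated arc does not wrap around, so
  translation on the circle is ordinary translation of representatives.\<close>

lemma translate_circle_I:
  assumes "0 \<le> j" "j < 2 ^ k"
  shows "(+) (circle_of (of_int j / 2 ^ k)) ` circle_I (2 ^ k) =
    {z. of_int j < 2 ^ k * circle_rep z \<and> 2 ^ k * circle_rep z < of_int j + 1}"
proof -
  note j = dyadic_bounds[OF assms]
  show ?thesis
  proof (intro set_eqI iffI)
    fix z assume "z \<in> (+) (circle_of (of_int j / 2 ^ k)) ` circle_I (2 ^ k)"
    then obtain r where r: "0 < r" "r < 1 / 2 ^ k" "z = circle_of (of_int j / 2 ^ k + r)"
      by (auto simp: circle_I_def circle_of_add)
    then have "of_int j / 2 ^ k + r < 1" "0 \<le> of_int j / 2 ^ k + r"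
      using j by (auto simp: add_divide_distrib)
    then have "circle_rep z = of_int j / 2 ^ k + r"
      using r frac_eq[of "of_int j / 2 ^ k + r"] by (simp add: circle_rep_of)
    then show "z \<in> {z. of_int j < 2 ^ k * circle_rep z \<and> 2 ^ k * circle_rep z < of_int j + 1}"
      using r by (auto simp: field_simps)
  next
    fix z assume z: "z \<in> {z. of_int j < 2 ^ k * circle_rep z \<and> 2 ^ k * circle_rep z < of_int j + 1}"
    define r where "r = circle_rep z - of_int j / 2 ^ k"
    have "z = circle_of (of_int j / 2 ^ k) + circle_of r"
      by (simp add: circle_of_add r_def)
    moreover have "2 ^ k * r = 2 ^ k * circle_rep z - of_int j"
      by (simp add: r_def right_diff_distrib)
    then have "0 < 2 ^ k * r" "2 ^ k * r < 1" using z by simp_all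
    then have "0 < r" "r < 1 / 2 ^ k"
      by (simp_all add: zero_less_mult_iff less_divide_eq mult.commute)
    ultimately show "z \<in> (+) (circle_of (of_int j / 2 ^ k)) ` circle_I (2 ^ k)"
      by (auto simp: circle_I_def)
  qed
qed

section \<open>Side lengths of the dyadic intervals\<close>

text \<open>The intervals of generation \<open>m\<close> have side \<open>2\<close> to the power \<open>- dyadic_expo m i\<close> in
  coordinate \<open>i\<close>. At \<open>m = 0\<close> truncated subtraction makes all exponents vanish, as wanted.\<close>

definition dyadic_expo :: "nat \<Rightarrow> nat \<Rightarrow> nat" where
  "dyadic_expo m i =
     (let n = floor_sqrt (m - 1); j = m - n\<^sup>2 in
      if j \<le> n then (if i < n then n else if i = n then j else 0)
      else (if i < j - n then n + 1 else if i \<le> n then n else 0))"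

lemma dyadic_expo_0 [simp]: "dyadic_expo 0 = (\<lambda>_. 0)"
  by (auto simp: dyadic_expo_def fun_eq_iff)

lemma dyadic_expo_block:
  assumes "1 \<le> j" "j \<le> 2 * n + 1"
  shows "dyadic_expo (n\<^sup>2 + j) i =
     (if j \<le> n then (if i < n then n else if i = n then j else 0)
      else (if i < j - n then n + 1 else if i \<le> n then n else 0))"
  using floor_sqrt_block[OF assms] by (simp add: dyadic_expo_def)

text \<open>Admitting \<open>n = 0\<close> puts generation 1 into the same scheme, as the single
  entry \<open>j = 1\<close> of block 0.\<close>

lemma block_decomposition:
  assumes "1 \<le> m"
  obtains n j :: nat where "m = n\<^sup>2 + j" "1 \<le> j" "j \<le> 2 * n + 1"
proof -
  obtain k where k: "m = Suc k" using assms by (cases m) auto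
  define n where "n = floor_sqrt k"
  have "n\<^sup>2 \<le> k" "k < (Suc n)\<^sup>2"
    unfolding n_def by (rule floor_sqrt_power2_le, rule Suc_floor_sqrt_power2_gt)
  moreover have "(Suc n)\<^sup>2 = n\<^sup>2 + 2 * n + 1" by (simp add: power2_eq_square)
  ultimately show ?thesis
    using k by (intro that[where n = n and j = "m - n\<^sup>2"]) linarith+
qed

text \<open>This is the halving of exactly one side. The bound on \<open>p\<close> also shows that
  generation \<open>m\<close> involves only coordinates below \<open>m\<close>.\<close>

lemma dyadic_expo_Suc: "\<exists>p\<le>m. dyadic_expo (Suc m) = (dyadic_expo m)(p := Suc (dyadic_expo m p))"
proof (cases "m = 0")
  case True
  have "dyadic_expo (Suc 0) = (\<lambda>_. 0)(0 := 1)"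
    using dyadic_expo_block[of 1 0] by (auto simp: fun_eq_iff)
  then show ?thesis using True by auto
next
  case False
  then obtain n j where m: "m = n\<^sup>2 + j" and j: "1 \<le> j" "j \<le> 2 * n + 1"
    using block_decomposition[of m] by auto
  show ?thesis
  proof (cases "j = 2 * n + 1")
    case True
    \<comment> \<open>At the end of block \<open>n\<close> the first \<open>n + 1\<close> sides all
      have exponent \<open>n + 1\<close>; the next generation halves the fresh coordinate
      \<open>n + 1\<close>.\<close>
    then have "Suc m = (n + 1)\<^sup>2 + 1" using m by (simp add: power2_eq_square)
    then have "dyadic_expo (Suc m) = (dyadic_expo m)(n + 1 := Suc (dyadic_expo m (n + 1)))"
      using dyadic_expo_block[of 1 "n + 1"] dyadic_expo_block[OF j] m True by (auto simp: fun_eq_iff)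
    moreover have "n + 1 \<le> m" using m True by simp
    ultimately show ?thesis by blast
  next
    case False
    \<comment> \<open>While \<open>j < n\<close>, the newest coordinate \<open>n\<close> is still
      catching up with the others. From \<open>j = n\<close> on, the coordinates 0, 1, ... are
      raised in turn from \<open>n\<close> to \<open>n + 1\<close>.\<close>
    define p where "p = (if j < n then n else j - n)"
    have "Suc m = n\<^sup>2 + (j + 1)" "j + 1 \<le> 2 * n + 1" using m j False by auto
    then have "dyadic_expo (Suc m) = (dyadic_expo m)(p := Suc (dyadic_expo m p))"
      using dyadic_expo_block[of "j + 1" n] dyadic_expo_block[OF j] m j
      by (auto simp: fun_eq_iff p_def)
    moreover have "p \<le> m" using m by (auto simp: p_def power2_eq_square intro: trans_le_add1)
    ultimately show ?thesis by blast
  qed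
qed

lemma dyadic_expo_eq_0: "m \<le> i \<Longrightarrow> dyadic_expo m i = 0"
proof (induction m)
  case (Suc m)
  obtain p where "p \<le> m" "dyadic_expo (Suc m) = (dyadic_expo m)(p := Suc (dyadic_expo m p))"
    using dyadic_expo_Suc by blast
  with Suc show ?case by auto
qed simp

text \<open>Each generation contributes one halving; this total is the reason why atoms of
  generation \<open>m\<close> have measure 2^-m.\<close>

lemma sum_dyadic_expo: "(\<Sum>i<m. dyadic_expo m i) = m"
proof (induction m)
  case (Suc m)
  obtain p where p: "p \<le> m" "dyadic_expo (Suc m) = (dyadic_expo m)(p := Suc (dyadic_expo m p))"
    using dyadic_expo_Suc by blast
  then have "(\<Sum>i<Suc m. dyadic_expo (Suc m) i) = (\<Sum>i<Suc m. dyadic_expo m i + (if i = p then 1 else 0))"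
    by (intro sum.cong) auto
  also have "\<dots> = Suc m"
    using p(1) Suc dyadic_expo_eq_0[of m m] by (simp add: sum.distrib)
  finally show ?case .
qed simp

text \<open>Along these generations every fixed coordinate is eventually resolved to precision 2^-n,
  which allows it to be recovered from the codes.\<close>

lemma dyadic_expo_square_add:
  assumes "i < n" shows "dyadic_expo (n\<^sup>2 + n) i = n"
  using assms dyadic_expo_block[of n n i] by auto

lemma dyadic_H_eq:
  assumes "1 \<le> m" shows "dyadic_H m = {x. \<forall>i. x i \<in> circle_R (2 ^ dyadic_expo m i)}"
proof -
  \<comment> \<open>Exponent 0 gives the trivial subgroup, so the vanishing of the trailing
    coordinates is part of the uniform description.\<close>
  have R1: "circle_R (Suc 0) = {0}"
    by (auto simp: circle_R_def zero_circle.abs_eq circle_of.abs_eq)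
  obtain n j where m: "m = n\<^sup>2 + j" and j: "1 \<le> j" "j \<le> 2 * n + 1"
    using block_decomposition[OF assms] .
  have "dyadic_H m = block_H n j"
  \<comment> \<open>The definition lists generation 1 separately; it agrees with
    \<open>block_H 0 1\<close>.\<close>
  proof (cases "n = 0")
    case True
    then have "m = 1" "j = 1" using m j by auto
    then show ?thesis using True by (simp add: dyadic_H_def block_H_def)
  qed (use dyadic_H_block[of n j] m j in simp)
  also have "\<dots> = {x. \<forall>i. x i \<in> circle_R (2 ^ dyadic_expo m i)}"
  proof (rule set_eqI, unfold mem_Collect_eq)
    fix x
    show "x \<in> block_H n j \<longleftrightarrow> (\<forall>i. x i \<in> circle_R (2 ^ dyadic_expo m i))"
    proof (cases "j \<le> n")
      case True
      have "(\<forall>i. x i \<in> circle_R (2 ^ dyadic_expo m i)) \<longleftrightarrow>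
          (\<forall>i. (i < n \<longrightarrow> x i \<in> circle_R (2 ^ n)) \<and> (i = n \<longrightarrow> x i \<in> circle_R (2 ^ j)) \<and>
            (i > n \<longrightarrow> x i = 0))"
        unfolding m dyadic_expo_block[OF j] using R1 True by (intro all_cong1) auto
      then show ?thesis using True by (auto simp: block_H_def)
    next
      case False
      have "(\<forall>i. x i \<in> circle_R (2 ^ dyadic_expo m i)) \<longleftrightarrow>
          (\<forall>i. (i < j - n \<longrightarrow> x i \<in> circle_R (2 ^ (n + 1))) \<and>
            (i \<in> {j - n..n} \<longrightarrow> x i \<in> circle_R (2 ^ n)) \<and> (i > n \<longrightarrow> x i = 0))"
      proof (intro all_cong1)
        fix i
        have "j - n \<le> n + 1" using j by linarith
        then consider "i < j - n" "i \<le> n" | "j - n \<le> i" "i \<le> n" | "j - n \<le> i" "n < i"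
          by linarith
        then show "x i \<in> circle_R (2 ^ dyadic_expo m i) \<longleftrightarrow> (i < j - n \<longrightarrow> x i \<in> circle_R (2 ^ (n + 1))) \<and>
            (i \<in> {j - n..n} \<longrightarrow> x i \<in> circle_R (2 ^ n)) \<and> (i > n \<longrightarrow> x i = 0)"
          by cases (simp_all add: m dyadic_expo_block[OF j] R1 False)
      qed
      then show ?thesis using False by (simp add: block_H_def all_conj_distrib Ball_def)
    qed
  qed
  finally show ?thesis .
qed

text \<open>The guard on positive exponents matters: \<open>circle_I 1\<close> is the circle without
  its zero, whereas a coordinate of exponent 0 is to be unrestricted.\<close>

lemma dyadic_V_eq:
  assumes "1 \<le> m" shows "dyadic_V m = {x. \<forall>i. 0 < dyadic_expo m i \<longrightarrow> x i \<in> circle_I (2 ^ dyadic_expo m i)}"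
proof -
  obtain n j where m: "m = n\<^sup>2 + j" and j: "1 \<le> j" "j \<le> 2 * n + 1"
    using block_decomposition[OF assms] .
  have "dyadic_V m = block_V n j"
  proof (cases "n = 0")
    case True
    then have "m = 1" "j = 1" using m j by auto
    then show ?thesis using True by (simp add: dyadic_V_def block_V_def)
  qed (use dyadic_V_block[of n j] m j in simp)
  also have "\<dots> = {x. \<forall>i. 0 < dyadic_expo m i \<longrightarrow> x i \<in> circle_I (2 ^ dyadic_expo m i)}"
  proof (rule set_eqI, unfold mem_Collect_eq)
    fix x
    show "x \<in> block_V n j \<longleftrightarrow> (\<forall>i. 0 < dyadic_expo m i \<longrightarrow> x i \<in> circle_I (2 ^ dyadic_expo m i))"
    proof (cases "j \<le> n")
      case True
      have "(\<forall>i. 0 < dyadic_expo m i \<longrightarrow> x i \<in> circle_I (2 ^ dyadic_expo m i)) \<longleftrightarrow>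
          (\<forall>i. (i < n \<longrightarrow> x i \<in> circle_I (2 ^ n)) \<and> (i = n \<longrightarrow> x i \<in> circle_I (2 ^ j)))"
        unfolding m dyadic_expo_block[OF j] using j True by (intro all_cong1) auto
      then show ?thesis using True by (auto simp: block_V_def)
    next
      case False
      have "(\<forall>i. 0 < dyadic_expo m i \<longrightarrow> x i \<in> circle_I (2 ^ dyadic_expo m i)) \<longleftrightarrow>
          (\<forall>i. (i < j - n \<longrightarrow> x i \<in> circle_I (2 ^ (n + 1))) \<and>
            (i \<in> {j - n..n} \<longrightarrow> x i \<in> circle_I (2 ^ n)))"
        unfolding m dyadic_expo_block[OF j] using j False by (intro all_cong1) auto
      then show ?thesis using False by (simp add: block_V_def all_conj_distrib Ball_def)
    qed
  qed
  finally show ?thesis .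
qed

section \<open>The dyadic filtration of the infinite torus\<close>

text \<open>Taking floors yields half-open boxes, which partition the torus exactly, while the open
  intervals miss their boundary points.\<close>

definition dyadic_code :: "nat \<Rightarrow> inf_torus \<Rightarrow> nat \<Rightarrow> int" where
  "dyadic_code m x = (\<lambda>i. \<lfloor>2 ^ dyadic_expo m i * circle_rep (x i)\<rfloor>)"

lemma space_haar [simp]: "space haar = UNIV"
  by (auto simp: haar_def space_PiM)

lemma measurable_haar_component [measurable]: "(\<lambda>x. x i) \<in> haar \<rightarrow>\<^sub>M borel"
proof -
  have "(\<lambda>x. x i) \<in> haar \<rightarrow>\<^sub>M circle_measure"
    unfolding haar_def by (rule measurable_component_singleton) simp
  then show ?thesis by (simp cong: measurable_cong_sets)
qed

lemma dyadic_code_bounds: "0 \<le> dyadic_code m x i" "dyadic_code m x i < 2 ^ dyadic_expo m i"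
proof -
  have "2 ^ dyadic_expo m i * circle_rep (x i) < 2 ^ dyadic_expo m i"
    using circle_rep_bounds(2)[of "x i"] by simp
  then show "dyadic_code m x i < 2 ^ dyadic_expo m i"
    by (simp add: dyadic_code_def floor_less_iff)
qed (simp add: dyadic_code_def circle_rep_bounds)

lemma dyadic_code_eq_0: "m \<le> i \<Longrightarrow> dyadic_code m x i = 0"
  using dyadic_code_bounds[of m x i] by (simp add: dyadic_expo_eq_0)

lemma finite_range_dyadic_code: "finite (range (dyadic_code m))"
proof (rule finite_subset)
  have "dyadic_expo m i \<le> m" if "i < m" for i
    using member_le_sum[of i "{..<m}" "dyadic_expo m"] that sum_dyadic_expo[of m] by simp
  then have "dyadic_code m x i \<le> 2 ^ m" if "i < m" for x i
    using dyadic_code_bounds(2)[of m x i] that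
    by (meson less_imp_le order_trans one_le_numeral power_increasing)
  then show "range (dyadic_code m) \<subseteq>
      {f. \<forall>i. (i \<in> {..<m} \<longrightarrow> f i \<in> {0..2 ^ m}) \<and> (i \<notin> {..<m} \<longrightarrow> f i = 0)}"
    by (auto simp: dyadic_code_bounds dyadic_code_eq_0)
qed (rule finite_set_of_finite_funs; simp)

lemma dyadic_code_sets [measurable]: "{x. dyadic_code m x = s} \<in> sets haar"
proof -
  have "{x \<in> space haar. \<forall>i. \<lfloor>2 ^ dyadic_expo m i * circle_rep (x i)\<rfloor> = s i} \<in> sets haar"
    by measurable
  then show ?thesis by (simp add: dyadic_code_def fun_eq_iff)
qed

lemma dyadic_code_Suc:
  assumes "dyadic_code (Suc m) x = dyadic_code (Suc m) y"
  shows "dyadic_code m x = dyadic_code m y"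
proof
  fix i
  obtain p where p: "dyadic_expo (Suc m) = (dyadic_expo m)(p := Suc (dyadic_expo m p))"
    using dyadic_expo_Suc by blast
  \<comment> \<open>Lowering the exponent by one drops the last binary digit, so the coarser label
    is computed from the finer one.\<close>
  have half: "\<lfloor>2 ^ e * r\<rfloor> = \<lfloor>2 ^ Suc e * r\<rfloor> div 2" for e :: nat and r :: real
    using floor_divide_real_eq_div[of 2 "2 ^ Suc e * r"] by simp
  have "dyadic_code (Suc m) x i = dyadic_code (Suc m) y i"
    using assms by simp
  then show "dyadic_code m x i = dyadic_code m y i"
    unfolding dyadic_code_def p
    using half[of "dyadic_expo m i" "circle_rep (x i)"] half[of "dyadic_expo m i" "circle_rep (y i)"]
    by (cases "i = p") simp_all
qed

lemma measure_dyadic_code: "measure haar {y. dyadic_code m y = dyadic_code m x} = 1 / 2 ^ m"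
proof -
  let ?A = "\<lambda>i. {z. \<lfloor>2 ^ dyadic_expo m i * circle_rep z\<rfloor> = dyadic_code m x i}"
  \<comment> \<open>From coordinate \<open>m\<close> on every label is 0, so equality of codes is a
    cylinder condition on the first \<open>m\<close> coordinates.\<close>
  have "dyadic_code m y = dyadic_code m x \<longleftrightarrow> (\<forall>i<m. y i \<in> ?A i)" for y
    using dyadic_code_eq_0[of m _ x] dyadic_code_eq_0[of m _ y]
    unfolding fun_eq_iff mem_Collect_eq by (metis dyadic_code_def not_le)
  then have "{y. dyadic_code m y = dyadic_code m x} =
      prod_emb UNIV (\<lambda>_. circle_measure) {..<m} (PiE {..<m} ?A)"
    by (auto simp: prod_emb_def)
  moreover have "?A i \<in> sets borel" for i by measurable
  ultimately have "emeasure haar {y. dyadic_code m y = dyadic_code m x} =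
      (\<Prod>i<m. emeasure circle_measure (?A i))"
    unfolding haar_def by (simp add: emeasure_PiM_emb prob_space_circle_measure)
  also have "\<dots> = (\<Prod>i<m. ennreal (1 / 2 ^ dyadic_expo m i))"
    by (intro prod.cong refl emeasure_circle_floor dyadic_code_bounds)
  also have "\<dots> = ennreal (\<Prod>i<m. 1 / 2 ^ dyadic_expo m i)"
    by (rule prod_ennreal) simp
  also have "(\<Prod>i<m. 1 / 2 ^ dyadic_expo m i) = (1 / 2 ^ m :: real)"
    by (simp only: prod_dividef power_sum[symmetric] sum_dyadic_expo prod.neutral_const)
  finally show ?thesis by (simp add: measure_def)
qed

text \<open>Codes are measurable with finite range, which gives one inclusion. Conversely, each
  coordinate is a limit of its binary truncations, and these are functions of the codes.\<close>

lemma sets_haar_generated: "sets haar = sigma_sets UNIV {{x. dyadic_code m x \<in> S} | m S. True}"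
proof
  let ?G = "{{x. dyadic_code m x \<in> S} | m S. True}"
  have "A \<in> sets haar" if "A \<in> ?G" for A
  proof -
    from that have "\<exists>m S. A = {x. dyadic_code m x \<in> S}" by simp
    then obtain m S where A: "A = {x. dyadic_code m x \<in> S}" by (elim exE)
    have "A = (\<Union>s\<in>S \<inter> range (dyadic_code m). {x. dyadic_code m x = s})"
      unfolding A by auto
    then show ?thesis
      by (auto intro!: sets.finite_UN finite_Int finite_range_dyadic_code)
  qed
  then show "sigma_sets UNIV ?G \<subseteq> sets haar"
    using sets.sigma_sets_subset[of ?G haar] by auto
  let ?N = "sigma UNIV ?G"
  have N: "sets ?N = sigma_sets UNIV ?G" "space ?N = UNIV" by simp_all
  have code: "(\<lambda>x. dyadic_code m x i) \<in> ?N \<rightarrow>\<^sub>M count_space UNIV" for m i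
  proof (rule measurableI)
    fix S :: "int set"
    have "(\<lambda>x. dyadic_code m x i) -` S \<inter> space ?N = {x. dyadic_code m x \<in> {f. f i \<in> S}}"
      by auto
    moreover have "{x. dyadic_code m x \<in> {f. f i \<in> S}} \<in> ?G"
      by (intro CollectI exI conjI) (rule refl, rule TrueI)
    ultimately show "(\<lambda>x. dyadic_code m x i) -` S \<inter> space ?N \<in> sets ?N"
      unfolding N(1) by (simp only: sigma_sets.Basic)
  qed simp
  \<comment> \<open>Truncation at \<open>n\<close> binary digits is eventually read off from
    generation \<open>n\<^sup>2 + n\<close>, namely as soon as \<open>n\<close> exceeds
    \<open>i\<close>.\<close>
  have rep: "(\<lambda>x. circle_rep (x i)) \<in> borel_measurable ?N" for i
  proof (rule borel_measurable_LIMSEQ_real)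
    fix x :: inf_torus
    let ?q = "\<lambda>n. of_int \<lfloor>2 ^ n * circle_rep (x i)\<rfloor> / 2 ^ n :: real"
    have "\<bar>?q n - circle_rep (x i)\<bar> \<le> (1 / 2) ^ n" for n
    proof -
      have "\<bar>of_int \<lfloor>2 ^ n * circle_rep (x i)\<rfloor> - 2 ^ n * circle_rep (x i)\<bar> \<le> 1" by linarith
      then have "\<bar>of_int \<lfloor>2 ^ n * circle_rep (x i)\<rfloor> - 2 ^ n * circle_rep (x i)\<bar> / 2 ^ n \<le> 1 / 2 ^ n"
        by (intro divide_right_mono) auto
      moreover have "?q n - circle_rep (x i) =
          (of_int \<lfloor>2 ^ n * circle_rep (x i)\<rfloor> - 2 ^ n * circle_rep (x i)) / 2 ^ n"
        by (simp add: diff_divide_distrib)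
      ultimately show ?thesis by (simp add: power_one_over)
    qed
    then have "\<forall>\<^sub>F n in sequentially. norm (?q n - circle_rep (x i)) \<le> (1 / 2) ^ n"
      unfolding real_norm_def by (intro always_eventually allI)
    moreover have "(\<lambda>n. (1 / 2) ^ n :: real) \<longlonglongrightarrow> 0"
      by (rule LIMSEQ_power_zero) simp
    ultimately have "(\<lambda>n. ?q n - circle_rep (x i)) \<longlonglongrightarrow> 0"
      by (rule Lim_null_comparison)
    then have "?q \<longlonglongrightarrow> circle_rep (x i)"
      by (rule LIM_zero_cancel)
    moreover have "\<forall>\<^sub>F n in sequentially. ?q n =
        of_int (dyadic_code (n\<^sup>2 + n) x i) / 2 ^ dyadic_expo (n\<^sup>2 + n) i"
      using eventually_gt_at_top[of i]
      by eventually_elim (simp add: dyadic_code_def dyadic_expo_square_add)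
    ultimately show "(\<lambda>n. of_int (dyadic_code (n\<^sup>2 + n) x i) / 2 ^ dyadic_expo (n\<^sup>2 + n) i)
        \<longlonglongrightarrow> circle_rep (x i)"
      by (rule Lim_transform_eventually)
  next
    show "(\<lambda>x. of_int (dyadic_code (n\<^sup>2 + n) x i) / 2 ^ dyadic_expo (n\<^sup>2 + n) i) \<in> borel_measurable ?N" for n
      using code[of "n\<^sup>2 + n" i] by measurable
  qed
  have "(\<lambda>x. x i) \<in> ?N \<rightarrow>\<^sub>M circle_measure" for i
    using measurable_compose[OF rep measurable_circle_of, of i]
    by (simp cong: measurable_cong_sets)
  \<comment> \<open>Measurability of the identity map is the remaining inclusion of
    sigma-algebras.\<close>
  then have "(\<lambda>x. x) \<in> ?N \<rightarrow>\<^sub>M haar"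
    unfolding haar_def by (intro measurable_PiM_single') auto
  then show "sets haar \<subseteq> sigma_sets UNIV ?G"
    using measurable_sets[of "\<lambda>x. x" ?N haar] N by auto
qed

interpretation torus: halving_filtration haar dyadic_code
proof (intro halving_filtration.intro prob_space_haar halving_filtration_axioms.intro,
    unfold space_haar)
  show "{y \<in> UNIV. dyadic_code m y = s} \<in> sets haar" for m s
    using dyadic_code_sets by simp
  show "measure haar {y \<in> UNIV. dyadic_code m y = dyadic_code m x} = 1 / 2 ^ m" for m x
    using measure_dyadic_code by simp
  show "sets haar = sigma_sets UNIV {{x \<in> UNIV. dyadic_code m x \<in> S} | m S. True}"
    unfolding sets_haar_generated by simp
qed (rule finite_range_dyadic_code dyadic_code_Suc, assumption?)+

text \<open>The open interval of the \<open>m\<close>th generation with the same code as \<open>x\<close>; it is the half-open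
  atom of \<open>x\<close> up to points having a dyadic coordinate.\<close>

definition dyadic_cell :: "nat \<Rightarrow> inf_torus \<Rightarrow> inf_torus set" where
  "dyadic_cell m x = {y. \<forall>i. 0 < dyadic_expo m i \<longrightarrow>
     of_int (dyadic_code m x i) < 2 ^ dyadic_expo m i * circle_rep (y i) \<and>
     2 ^ dyadic_expo m i * circle_rep (y i) < of_int (dyadic_code m x i) + 1}"

lemma dyadic_cell_cong: "dyadic_code m x = dyadic_code m y \<Longrightarrow> dyadic_cell m x = dyadic_cell m y"
  by (simp add: dyadic_cell_def)

lemma dyadic_cell_in_intervals:
  assumes "1 \<le> m" shows "dyadic_cell m x \<in> dyadic_intervals"
proof -
  \<comment> \<open>The translation vector is the lower corner of the box; the bounds on the labels
    place it in \<open>dyadic_H m\<close>.\<close>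
  define t where "t i = circle_of (of_int (dyadic_code m x i) / 2 ^ dyadic_expo m i)" for i
  have "t i \<in> circle_R (2 ^ dyadic_expo m i)" for i
    unfolding circle_R_def
    using dyadic_code_bounds[of m x i]
    by (intro CollectI exI[of _ "nat (dyadic_code m x i)"]) (auto simp: t_def nat_less_iff)
  then have "t \<in> dyadic_H m" by (simp add: dyadic_H_eq[OF assms])
  moreover have "(+) t ` dyadic_V m = dyadic_cell m x"
  proof -
    have cell: "y \<in> dyadic_cell m x \<longleftrightarrow>
        (\<forall>i. 0 < dyadic_expo m i \<longrightarrow> y i \<in> (+) (t i) ` circle_I (2 ^ dyadic_expo m i))" for y
      unfolding t_def using translate_circle_I[OF dyadic_code_bounds[of m x]]
      by (simp add: dyadic_cell_def)
    show ?thesis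
    proof (intro set_eqI iffI)
      fix y assume "y \<in> (+) t ` dyadic_V m"
      then show "y \<in> dyadic_cell m x"
        by (auto simp: cell dyadic_V_eq[OF assms])
    next
      fix y assume y: "y \<in> dyadic_cell m x"
      have "y i - t i \<in> circle_I (2 ^ dyadic_expo m i)" if i: "0 < dyadic_expo m i" for i
      proof -
        obtain c where "c \<in> circle_I (2 ^ dyadic_expo m i)" "y i = t i + c"
          using y[unfolded cell, rule_format, OF i] by blast
        then show ?thesis by simp
      qed
      then have "y - t \<in> dyadic_V m"
        by (simp add: dyadic_V_eq[OF assms])
      moreover have "y = t + (y - t)" by (simp add: fun_eq_iff)
      ultimately show "y \<in> (+) t ` dyadic_V m" by blast
    qed
  qed
  ultimately show ?thesis using assms unfolding dyadic_intervals_def by blast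
qed

lemma open_dyadic_cell: "open (dyadic_cell m x)"
proof -
  let ?W = "\<lambda>i. {z. of_int (dyadic_code m x i) / 2 ^ dyadic_expo m i < circle_rep z \<and>
      circle_rep z < (of_int (dyadic_code m x i) + 1) / 2 ^ dyadic_expo m i}"
  have "open ((\<lambda>y. y i) -` ?W i)" for i
    using dyadic_bounds[OF dyadic_code_bounds[of m x i]]
    by (intro open_vimage open_circle_rep_interval) auto
  \<comment> \<open>Only finitely many coordinates are constrained, so a finite intersection of open
    cylinders suffices.\<close>
  then have "open (\<Inter>i\<in>{i. i < m \<and> 0 < dyadic_expo m i}. (\<lambda>y. y i) -` ?W i)"
    by (intro open_INT) auto
  also have "(\<Inter>i\<in>{i. i < m \<and> 0 < dyadic_expo m i}. (\<lambda>y. y i) -` ?W i) = dyadic_cell m x"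
  proof -
    have "0 < dyadic_expo m i \<Longrightarrow> i < m" for i
      using dyadic_expo_eq_0[of m i] by (cases "i < m") auto
    then show ?thesis
      by (auto simp: dyadic_cell_def divide_less_eq less_divide_eq mult.commute)
  qed
  finally show ?thesis .
qed

lemma dyadic_cell_sets [measurable]: "dyadic_cell m x \<in> sets haar"
proof -
  have "{y \<in> space haar. \<forall>i. 0 < dyadic_expo m i \<longrightarrow>
     of_int (dyadic_code m x i) < 2 ^ dyadic_expo m i * circle_rep (y i) \<and>
     2 ^ dyadic_expo m i * circle_rep (y i) < of_int (dyadic_code m x i) + 1} \<in> sets haar"
    by measurable
  then show ?thesis by (simp add: dyadic_cell_def)
qed

lemma dyadic_code_eq_if_in_cell:
  assumes "y \<in> dyadic_cell m x" shows "dyadic_code m y = dyadic_code m x"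
proof
  fix i
  show "dyadic_code m y i = dyadic_code m x i"
  proof (cases "dyadic_expo m i = 0")
    case True
    then show ?thesis using dyadic_code_bounds[of m y i] dyadic_code_bounds[of m x i] by simp
  next
    case False
    then show ?thesis
      using assms unfolding dyadic_cell_def dyadic_code_def[of m y]
      by (intro floor_unique) (auto intro: less_imp_le)
  qed
qed

text \<open>A point can miss its own open cell only through equality at a lower endpoint, which
  would make one of these multiples an integer.\<close>

lemma in_own_dyadic_cell:
  assumes "\<forall>k i. 2 ^ k * circle_rep (y i) \<notin> \<int>"
  shows "y \<in> dyadic_cell m y"
proof -
  have "of_int (dyadic_code m y i) < 2 ^ dyadic_expo m i * circle_rep (y i)" for i
  proof -
    have "of_int (dyadic_code m y i) \<noteq> 2 ^ dyadic_expo m i * circle_rep (y i)"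
      using assms by (metis Ints_of_int)
    then show ?thesis unfolding dyadic_code_def by linarith
  qed
  moreover have "2 ^ dyadic_expo m i * circle_rep (y i) < of_int (dyadic_code m y i) + 1" for i
    unfolding dyadic_code_def by linarith
  ultimately show ?thesis by (simp add: dyadic_cell_def)
qed

lemma AE_haar_not_dyadic: "AE y in haar. \<forall>k i. 2 ^ k * circle_rep (y i) \<notin> \<int>"
proof -
  have "AE y in haar. 2 ^ k * circle_rep (y i) \<notin> \<int>" for k i
    unfolding haar_def
    by (rule AE_PiM_component[where P = "\<lambda>z. 2 ^ k * circle_rep z \<notin> \<int>"])
      (simp_all add: prob_space_circle_measure AE_circle_not_dyadic)
  then show ?thesis by (simp add: AE_all_countable)
qed

lemma AE_dyadic_cell_iff_atom: "AE y in haar. y \<in> dyadic_cell m x \<longleftrightarrow> y \<in> torus.atom m x"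
  using AE_haar_not_dyadic
proof eventually_elim
  fix y :: inf_torus assume "\<forall>k i. 2 ^ k * circle_rep (y i) \<notin> \<int>"
  then have "y \<in> dyadic_cell m y" by (rule in_own_dyadic_cell)
  then show "y \<in> dyadic_cell m x \<longleftrightarrow> y \<in> torus.atom m x"
    using dyadic_code_eq_if_in_cell[of y m x] dyadic_cell_cong[of m y x]
    by (auto simp: torus.atom_def)
qed

text \<open>Cell and atom agree almost everywhere, so the averages studied along the filtration are
  those over the open intervals.\<close>

lemma dyadic_cell_average:
  fixes g :: "inf_torus \<Rightarrow> real"
  assumes [measurable]: "g \<in> borel_measurable haar"
  shows "1 / measure haar (dyadic_cell m x) * (LINT y:dyadic_cell m x|haar. g y) = torus.avg g m x"
proof -
  have "measure haar (dyadic_cell m x) = measure haar (torus.atom m x)"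
    by (rule measure_eq_AE[OF AE_dyadic_cell_iff_atom]) auto
  moreover have "(LINT y:dyadic_cell m x|haar. g y) = (LINT y:torus.atom m x|haar. g y)"
    using AE_dyadic_cell_iff_atom[of m x]
    by (intro set_integral_cong_set) (auto simp: set_borel_measurable_def eq_commute)
  ultimately show ?thesis
    by (simp add: torus.avg_def torus.measure_atom)
qed

section \<open>The decomposition into stopped cells\<close>

theorem theorem9:
  fixes f :: "inf_torus \<Rightarrow> complex" and a :: real
  assumes "integrable haar f"
    and "a > (LINT x|haar. norm (f x))"
  shows "\<exists>F \<Omega>. closed F \<and> open \<Omega> \<and> \<Omega> = UNIV - F \<and>
    (AE x in haar. x \<in> F \<longrightarrow> norm (f x) \<le> a) \<and>
    (\<exists>\<I>. countable \<I> \<and> \<I> \<subseteq> dyadic_intervals \<and> disjoint \<I> \<and> \<Omega> = \<Union>\<I> \<and>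
      (\<forall>I\<in>\<I>. a \<le> 1 / measure haar I * (LINT x:I|haar. norm (f x)) \<and>
              1 / measure haar I * (LINT x:I|haar. norm (f x)) \<le> 2 * a)) \<and>
    measure haar \<Omega> \<le> (LINT x|haar. norm (f x)) / a"
proof -
  define g where "g = (\<lambda>x. norm (f x))"
  have g: "integrable haar g" "\<And>x. 0 \<le> g x" and ga: "(LINT x|haar. g x) < a"
    using assms by (auto simp: g_def)
  have [measurable]: "g \<in> borel_measurable haar" using g(1) by auto
  have "0 \<le> (LINT x|haar. g x)" using g(2) by simp
  then have a: "0 < a" using ga by linarith
  define \<I> where "\<I> = {dyadic_cell m x | m x. torus.stops g a m x}"
  define \<Omega> where "\<Omega> = \<Union>\<I>"
  have open_\<Omega>: "open \<Omega>"
    unfolding \<Omega>_def \<I>_def by (auto intro: open_dyadic_cell)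
  have "countable \<I>"
  proof -
    have "finite (range (dyadic_cell m))" for m
    proof -
      \<comment> \<open>A cell depends only on the code, and each generation has finitely many
        codes. A chosen point for every code therefore exhausts the cells.\<close>
      have "dyadic_cell m x = dyadic_cell m (inv (dyadic_code m) (dyadic_code m x))" for x
        by (rule dyadic_cell_cong) (simp add: f_inv_into_f)
      then have "range (dyadic_cell m) \<subseteq> (\<lambda>s. dyadic_cell m (inv (dyadic_code m) s)) ` range (dyadic_code m)"
        by blast
      then show ?thesis
        using finite_range_dyadic_code finite_surj by blast
    qed
    then have "countable (\<Union>m. range (dyadic_cell m))"
      by (intro countable_UN) (auto intro: countable_finite)
    then show ?thesis
      by (rule countable_subset[rotated]) (auto simp: \<I>_def)
  qed
  moreover have "\<I> \<subseteq> dyadic_intervals"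
    using torus.stops_bounds(1)[OF g ga] dyadic_cell_in_intervals
    by (auto simp: \<I>_def Suc_le_eq)
  moreover have "disjoint \<I>"
  proof (rule disjointI)
    fix I J assume "I \<in> \<I>" "J \<in> \<I>" and ne: "I \<noteq> J"
    then obtain m x n y where I: "I = dyadic_cell m x" "torus.stops g a m x"
      and J: "J = dyadic_cell n y" "torus.stops g a n y"
      by (auto simp: \<I>_def)
    show "I \<inter> J = {}"
    proof (rule ccontr)
      assume "I \<inter> J \<noteq> {}"
      \<comment> \<open>A common point \<open>z\<close> shares the labels of both cells and hence
        stops at both generations. Uniqueness gives \<open>m = n\<close>, and the two cells then
        have the same code.\<close>
      then obtain z where z: "dyadic_code m z = dyadic_code m x" "dyadic_code n z = dyadic_code n y"
        using I J dyadic_code_eq_if_in_cell by blast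
      then have "torus.stops g a m z" "torus.stops g a n z"
        using I(2) J(2) torus.stops_cong[OF _ _ z(1)] torus.stops_cong[OF _ _ z(2)] by simp_all
      then have "m = n" by (rule torus.stops_unique)
      then show False using ne z I J dyadic_cell_cong by metis
    qed
  qed
  moreover have "a \<le> 1 / measure haar I * (LINT x:I|haar. g x) \<and>
      1 / measure haar I * (LINT x:I|haar. g x) \<le> 2 * a" if "I \<in> \<I>" for I
    using that torus.stops_bounds(2,3)[OF g ga]
    by (auto simp: \<I>_def dyadic_cell_average simp del: times_divide_eq_left mult_1)
  moreover have "AE x in haar. x \<in> - \<Omega> \<longrightarrow> g x \<le> a"
    using torus.AE_le_if_avg_less[OF g(1), of a] AE_haar_not_dyadic
  proof eventually_elim
    fix x assume less: "(\<forall>m. torus.avg g m x < a) \<longrightarrow> g x \<le> a"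
      and x: "\<forall>k i. 2 ^ k * circle_rep (x i) \<notin> \<int>"
    \<comment> \<open>An average reaching \<open>a\<close> would produce a first stopping
      generation. Having no dyadic coordinate, \<open>x\<close> would lie in its own cell of that
      generation, hence in the union of the stopped cells.\<close>
    have "torus.avg g m x < a" if "x \<notin> \<Omega>" for m
    proof (rule ccontr)
      assume "\<not> torus.avg g m x < a"
      then obtain n where "torus.stops g a n x"
        using torus.ex_stops[of a g m x] by (auto simp: not_less)
      then have "x \<in> \<Omega>"
        using in_own_dyadic_cell[OF x, of n] unfolding \<Omega>_def \<I>_def by blast
      with that show False by simp
    qed
    with less show "x \<in> - \<Omega> \<longrightarrow> g x \<le> a" by simp
  qed
  moreover have "measure haar \<Omega> \<le> (LINT x|haar. g x) / a"
  proof -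
    \<comment> \<open>Every point of a stopped cell has the code of the cell and so stops at the
      same generation; this holds everywhere, with no null set to discard.\<close>
    have "\<Omega> \<subseteq> {x \<in> space haar. \<exists>m. torus.stops g a m x}"
    proof
      fix y assume "y \<in> \<Omega>"
      then obtain m x where x: "torus.stops g a m x" and y: "y \<in> dyadic_cell m x"
        by (auto simp: \<Omega>_def \<I>_def)
      then have "torus.stops g a m y"
        using torus.stops_cong[OF _ _ dyadic_code_eq_if_in_cell[OF y]] by simp
      then show "y \<in> {x \<in> space haar. \<exists>m. torus.stops g a m x}" by auto
    qed
    moreover have "{x \<in> space haar. \<exists>m. torus.stops g a m x} \<in> sets haar"
    proof -
      have "{x \<in> space haar. \<exists>m. torus.stops g a m x} =
          (\<Union>m. {x \<in> space haar. torus.stops g a m x})" by auto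
      also have "\<dots> \<in> sets haar"
        using torus.saturated_sets[OF torus.saturated_stops] by (intro sets.countable_UN) blast
      finally show ?thesis .
    qed
    ultimately have "measure haar \<Omega> \<le> measure haar {x \<in> space haar. \<exists>m. torus.stops g a m x}"
      by (rule torus.finite_measure_mono)
    also have "\<dots> \<le> (LINT x|haar. g x) / a"
      by (rule torus.measure_stops_le[OF g a])
    finally show ?thesis .
  qed
  ultimately show ?thesis
    using open_\<Omega> unfolding g_def
    by (intro exI[of _ "- \<Omega>"] exI[of _ \<Omega>] conjI exI[of _ \<I>] ballI)
      (simp_all add: closed_Compl Compl_eq_Diff_UNIV[symmetric] \<Omega>_def[symmetric])
qed

end
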